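(* Let $\alpha\in(1/(n+1),1)$ and let $((X_1,Y_1),\dots,(X_{n+1},Y_{n+1}))\in(\mathbb{R}^k\times\mathbb{R}^\ell)^{n+1}$ be exchangeable pairs of random vectors. With $d_n^X$, $q'_{n,\alpha}$, $Z_0^n$, $\boldsymbol{\mathcal A}_n$ as defined in the context, set $$t_n=\Big(\frac{n+1}{n}\Big)(1+d_n^X).$$ If $t_nq'_{n,\alpha}\ge n$, set $\mathcal F_\alpha^n=\mathbb{R}^\ell$. Otherwise set $$\mathcal F_\alpha^n=\{z\in\mathbb{R}^\ell:\ (z-Z_0^n)^\top\boldsymbol{\mathcal A}_n^{-1}(z-Z_0^n)\le\rho'_{n,\alpha}\},\qquad \rho'_{n,\alpha}=t_n^2\,\frac{q'_{n,\alpha}}{1-t_nq'_{n,\alpha}/n}.$$ Then $$\mathbb{P}(Y_{n+1}-\widehat Y_{n+1}\in\mathcal F_\alpha^n)\ge1-\alpha.$$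
   Context: $k,\ell\ge1$, $p=k+\ell$; $\lambda>0$ is a fixed ridge parameter; $\widehat f:\mathbb{R}^k\to\mathbb{R}^\ell$ is a fixed deterministic measurable predictor. $\widehat Y_i=\widehat f(X_i)$, $R_i=Y_i-\widehat Y_i$, $V_i=(X_i^\top\ R_i^\top)^\top\in\mathbb{R}^p$. $\overline X_n,\overline R_n,\overline V_n$ are the averages over $i=1,\dots,n$, and $X_{n+1}^{\mathrm c}=X_{n+1}-\overline X_n$. $\mathbf B_n$ is the $n\times p$ matrix with $i$-th row $(V_i-\overline V_n)^\top$, $\mathbf B_n^X$ its left $n\times k$ block, and $$\widehat{\boldsymbol\Sigma}_{n,\lambda}=\tfrac1n\mathbf B_n^\top\mathbf B_n+\lambda\mathbf I_p=\begin{pmatrix}\widehat{\boldsymbol\Sigma}_{n,\lambda}^{11}&\widehat{\boldsymbol\Sigma}_n^{12}\\ \widehat{\boldsymbol\Sigma}_n^{21}&\widehat{\boldsymbol\Sigma}_{n,\lambda}^{22}\end{pmatrix}$$ in blocks according to $p=k+\ell$. $\boldsymbol{\mathcal A}_n=\widehat{\boldsymbol\Sigma}_{n,\lambda}/\widehat{\boldsymbol\Sigma}_{n,\lambda}^{11}=\widehat{\boldsymbol\Sigma}_{n,\lambda}^{22}-\widehat{\boldsymbol\Sigma}_n^{21}(\widehat{\boldsymbol\Sigma}_{n,\lambda}^{11})^{-1}\widehat{\boldsymbol\Sigma}_n^{12}$ and $Z_0^n=\widehat{\boldsymbol\Sigma}_n^{21}(\widehat{\boldsymbol\Sigma}_{n,\lambda}^{11})^{-1}X_{n+1}^{\mathrm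 c}+\overline R_n$. $\mathbf P_{n,\lambda}=\mathbf B_n(\mathbf B_n^\top\mathbf B_n+n\lambda\mathbf I_p)^{-1}\mathbf B_n^\top$ and $\mathbf P_{n,\lambda}^{XX}=\mathbf B_n^X((\mathbf B_n^X)^\top\mathbf B_n^X+n\lambda\mathbf I_k)^{-1}(\mathbf B_n^X)^\top$. $d_n^X=\frac1{n+1}(X_{n+1}^{\mathrm c})^\top(\widehat{\boldsymbol\Sigma}_{n,\lambda}^{11})^{-1}X_{n+1}^{\mathrm c}$. Let $v=\frac1{n+1}(-1,\dots,-1,n)^\top\in\mathbb{R}^{n+1}$ (so $\|v\|^2=n/(n+1)$), $w=v/\|v\|$, and $$b_X^n=\frac{\|v\|}{n}\begin{pmatrix}\mathbf B_n^X(\widehat{\boldsymbol\Sigma}_{n,\lambda}^{11})^{-1}X_{n+1}^{\mathrm c}\\0\end{pmatrix}-w\in\mathbb{R}^{n+1}.$$ For $1\le i\le n$, $p'_{i,n}=(\mathbf P_{n,\lambda}-\mathbf P_{n,\lambda}^{XX})_{ii}+\frac{(b_X^n)_i^2}{1+d_n^X}$; $n_\alpha=\lceil(1-\alpha)(n+1)\rceil$; $q'_{n,\alpha}=n\,p'_{(n_\alpha)}$ where $p'_{(n_\alpha)}$ is the $n_\alpha$-th smallest of $(p'_{1,n},\dots,p'_{n,n})$. *)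

theory Defs
  imports "HOL-Probability.Probability"
begin

text \<open>
  Index conventions. The sample size is \<open>n = CARD('n)\<close>. The calibration observations
  \<open>1, \<dots>, n\<close> are indexed by \<open>'n\<close>; the full sample of size \<open>n + 1\<close>, as well as the coordinates
  of \<open>\<real>\<^sup>n\<^sup>+\<^sup>1\<close>, are indexed by \<open>'n option\<close>, where \<open>Some i\<close> is a calibration index and
  \<open>None\<close> is the last index \<open>n + 1\<close>. The coordinates of \<open>\<real>\<^sup>p = \<real>\<^sup>k \<times> \<real>\<^sup>l\<close> are indexed by
  \<open>'k + 'l\<close>, so \<open>p = CARD('k) + CARD('l)\<close>.

  The quantities below are functions of a realised sample: \<open>x\<close> are the calibration
  covariates, \<open>r\<close> the calibration residuals and \<open>x'\<close> the covariate \<open>X\<close> of index \<open>n + 1\<close>.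
\<close>

text \<open>All components are measurable, and the joint law is invariant under permutations.\<close>

definition exchangeable :: "'w measure \<Rightarrow> 'a measure \<Rightarrow> ('i \<Rightarrow> 'w \<Rightarrow> 'a) \<Rightarrow> bool" where
  "exchangeable M N Z \<longleftrightarrow>
     (\<forall>i. Z i \<in> measurable M N) \<and>
     (\<forall>\<pi>. \<pi> permutes UNIV \<longrightarrow>
        distr M (Pi\<^sub>M UNIV (\<lambda>_. N)) (\<lambda>\<omega> i. Z (\<pi> i) \<omega>) =
        distr M (Pi\<^sub>M UNIV (\<lambda>_. N)) (\<lambda>\<omega> i. Z i \<omega>))"

definition avg :: "('n::finite \<Rightarrow> 'a::real_vector) \<Rightarrow> 'a" where
  "avg x = (1 / real CARD('n)) *\<^sub>R (\<Sum>i\<in>UNIV. x i)"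

definition stack :: "real^'k \<Rightarrow> real^'l \<Rightarrow> real^('k::finite + 'l::finite)" where
  "stack x r = (\<chi> s. case s of Inl a \<Rightarrow> x $ a | Inr b \<Rightarrow> r $ b)"

definition Bmat ::
  "('n::finite \<Rightarrow> real^'k::finite) \<Rightarrow> ('n \<Rightarrow> real^'l::finite) \<Rightarrow> real^('k + 'l)^'n" where
  "Bmat x r = (\<chi> i. stack (x i) (r i) - avg (\<lambda>j. stack (x j) (r j)))"

definition BXmat ::
  "('n::finite \<Rightarrow> real^'k::finite) \<Rightarrow> ('n \<Rightarrow> real^'l::finite) \<Rightarrow> real^'k^'n" where
  "BXmat x r = (\<chi> i a. Bmat x r $ i $ Inl a)"

definition Sig ::
  "real \<Rightarrow> ('n::finite \<Rightarrow> real^'k::finite) \<Rightarrow> ('n \<Rightarrow> real^'l::finite)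
    \<Rightarrow> real^('k + 'l)^('k + 'l)" where
  "Sig lam x r =
     (1 / real CARD('n)) *\<^sub>R (transpose (Bmat x r) ** Bmat x r) + lam *\<^sub>R mat 1"

definition Sig11 ::
  "real \<Rightarrow> ('n::finite \<Rightarrow> real^'k::finite) \<Rightarrow> ('n \<Rightarrow> real^'l::finite) \<Rightarrow> real^'k^'k" where
  "Sig11 lam x r = (\<chi> a b. Sig lam x r $ Inl a $ Inl b)"

text \<open>The off-diagonal blocks do not depend on \<open>lam\<close>.\<close>

definition Sig12 ::
  "real \<Rightarrow> ('n::finite \<Rightarrow> real^'k::finite) \<Rightarrow> ('n \<Rightarrow> real^'l::finite) \<Rightarrow> real^'l^'k" where
  "Sig12 lam x r = (\<chi> a b. Sig lam x r $ Inl a $ Inr b)"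

definition Sig21 ::
  "real \<Rightarrow> ('n::finite \<Rightarrow> real^'k::finite) \<Rightarrow> ('n \<Rightarrow> real^'l::finite) \<Rightarrow> real^'k^'l" where
  "Sig21 lam x r = (\<chi> a b. Sig lam x r $ Inr a $ Inl b)"

definition Sig22 ::
  "real \<Rightarrow> ('n::finite \<Rightarrow> real^'k::finite) \<Rightarrow> ('n \<Rightarrow> real^'l::finite) \<Rightarrow> real^'l^'l" where
  "Sig22 lam x r = (\<chi> a b. Sig lam x r $ Inr a $ Inr b)"

definition schurA ::
  "real \<Rightarrow> ('n::finite \<Rightarrow> real^'k::finite) \<Rightarrow> ('n \<Rightarrow> real^'l::finite) \<Rightarrow> real^'l^'l" where
  "schurA lam x r =
     Sig22 lam x r - Sig21 lam x r ** matrix_inv (Sig11 lam x r) ** Sig12 lam x r"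

definition xc :: "('n::finite \<Rightarrow> real^'k::finite) \<Rightarrow> real^'k \<Rightarrow> real^'k" where
  "xc x x' = x' - avg x"

definition Z0 ::
  "real \<Rightarrow> ('n::finite \<Rightarrow> real^'k::finite) \<Rightarrow> ('n \<Rightarrow> real^'l::finite) \<Rightarrow> real^'k \<Rightarrow> real^'l" where
  "Z0 lam x r x' = (Sig21 lam x r ** matrix_inv (Sig11 lam x r)) *v xc x x' + avg r"

definition Pmat ::
  "real \<Rightarrow> ('n::finite \<Rightarrow> real^'k::finite) \<Rightarrow> ('n \<Rightarrow> real^'l::finite) \<Rightarrow> real^'n^'n" where
  "Pmat lam x r =
     Bmat x r ** matrix_inv (transpose (Bmat x r) ** Bmat x r
                               + (real CARD('n) * lam) *\<^sub>R mat 1)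
       ** transpose (Bmat x r)"

definition PXXmat ::
  "real \<Rightarrow> ('n::finite \<Rightarrow> real^'k::finite) \<Rightarrow> ('n \<Rightarrow> real^'l::finite) \<Rightarrow> real^'n^'n" where
  "PXXmat lam x r =
     BXmat x r ** matrix_inv (transpose (BXmat x r) ** BXmat x r
                               + (real CARD('n) * lam) *\<^sub>R mat 1)
       ** transpose (BXmat x r)"

definition dX ::
  "real \<Rightarrow> ('n::finite \<Rightarrow> real^'k::finite) \<Rightarrow> ('n \<Rightarrow> real^'l::finite) \<Rightarrow> real^'k \<Rightarrow> real" where
  "dX lam x r x' =
     1 / (real CARD('n) + 1) * (xc x x' \<bullet> (matrix_inv (Sig11 lam x r) *v xc x x'))"

definition vvec :: "real^('n::finite option)" where
  "vvec = (1 / (real CARD('n) + 1)) *\<^sub>R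
            (\<chi> j. case j of Some _ \<Rightarrow> - 1 | None \<Rightarrow> real CARD('n))"

definition wvec :: "real^('n::finite option)" where
  "wvec = (1 / norm (vvec :: real^('n option))) *\<^sub>R vvec"

definition bX ::
  "real \<Rightarrow> ('n::finite \<Rightarrow> real^'k::finite) \<Rightarrow> ('n \<Rightarrow> real^'l::finite) \<Rightarrow> real^'k
    \<Rightarrow> real^('n option)" where
  "bX lam x r x' =
     (norm (vvec :: real^('n option)) / real CARD('n)) *\<^sub>R
       (\<chi> j. case j of
          Some i \<Rightarrow> (BXmat x r *v (matrix_inv (Sig11 lam x r) *v xc x x')) $ i
        | None \<Rightarrow> 0)
     - wvec"

definition pscore ::
  "real \<Rightarrow> ('n::finite \<Rightarrow> real^'k::finite) \<Rightarrow> ('n \<Rightarrow> real^'l::finite) \<Rightarrow> real^'k \<Rightarrow> 'n \<Rightarrow> real" where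
  "pscore lam x r x' i =
     (Pmat lam x r - PXXmat lam x r) $ i $ i
     + (bX lam x r x' $ Some i)\<^sup>2 / (1 + dX lam x r x')"

text \<open>The \<open>m\<close>-th smallest value of a finite family, with multiplicities, for
  \<open>1 \<le> m \<le> CARD('n)\<close>.\<close>

definition order_stat :: "('n::finite \<Rightarrow> real) \<Rightarrow> nat \<Rightarrow> real" where
  "order_stat s m = sorted_list_of_multiset (image_mset s (mset_set UNIV)) ! (m - 1)"

definition qcut ::
  "real \<Rightarrow> real \<Rightarrow> ('n::finite \<Rightarrow> real^'k::finite) \<Rightarrow> ('n \<Rightarrow> real^'l::finite) \<Rightarrow> real^'k
    \<Rightarrow> real" where
  "qcut lam alpha x r x' =
     real CARD('n) *
       order_stat (pscore lam x r x') (nat \<lceil>(1 - alpha) * (real CARD('n) + 1)\<rceil>)"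

definition tfac ::
  "real \<Rightarrow> ('n::finite \<Rightarrow> real^'k::finite) \<Rightarrow> ('n \<Rightarrow> real^'l::finite) \<Rightarrow> real^'k \<Rightarrow> real" where
  "tfac lam x r x' =
     (real CARD('n) + 1) / real CARD('n) * (1 + dX lam x r x')"

definition rho ::
  "real \<Rightarrow> real \<Rightarrow> ('n::finite \<Rightarrow> real^'k::finite) \<Rightarrow> ('n \<Rightarrow> real^'l::finite) \<Rightarrow> real^'k
    \<Rightarrow> real" where
  "rho lam alpha x r x' =
     (tfac lam x r x')\<^sup>2 *
       (qcut lam alpha x r x' /
          (1 - tfac lam x r x' * qcut lam alpha x r x' / real CARD('n)))"

definition Fset ::
  "real \<Rightarrow> real \<Rightarrow> ('n::finite \<Rightarrow> real^'k::finite) \<Rightarrow> ('n \<Rightarrow> real^'l::finite) \<Rightarrow> real^'k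
    \<Rightarrow> (real^'l) set" where
  "Fset lam alpha x r x' =
     (if tfac lam x r x' * qcut lam alpha x r x' \<ge> real CARD('n) then UNIV
      else {z. (z - Z0 lam x r x') \<bullet>
                 (matrix_inv (schurA lam x r) *v (z - Z0 lam x r x'))
               \<le> rho lam alpha x r x'})"

end

theory Submission
  imports Defs
begin

text \<open>
  Why the coverage holds. Put all \<open>n + 1\<close> pairs on the same footing: give the pair with
  index \<open>j\<close> the score \<open>p\<^sub>j\<close>, its ridge leverage in the full centred sample of the stacked vectors
  \<open>(X, R)\<close> minus its ridge leverage in the full centred sample of the covariates alone, both with
  penalty \<open>n \<lambda>\<close>. Leverages do not depend on the order of the sample, so the scores are
  permuted along with the data, and exchangeability makes the event ``fewer than \<open>m\<close> scores
  are strictly below \<open>p\<^sub>j\<close>'' equally likely for every \<open>j\<close>. At least \<open>m\<close> indices always have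
  this property, so its probability is at least \<open>m / (n + 1)\<close>
  (\<open>exchangeable_rank_coverage\<close>). With \<open>m = n\<^sub>\<alpha>\<close> this is at least \<open>1 - \<alpha>\<close>.

  It remains to see that the rank event for the last index forces the last residual into
  the prediction set. Passing from \<open>n\<close> to \<open>n + 1\<close> observations changes the centred Gram matrix
  by the rank-one term \<open>(n / (n + 1)) u u\<^sup>T\<close>, where \<open>u\<close> is the deviation of the last
  observation from the mean of the others (\<open>ridge_centred_option\<close>). The Sherman-Morrison formula
  then gives, with \<open>d\<close> the normalised Mahalanobis norm of \<open>u\<close>,
  \<^item> for a calibration index, \<open>p\<^sub>i = p'\<^sub>i - b\<^sub>i\<^sup>2 / (1 + d)\<close>, where \<open>p'\<^sub>i\<close> is \<open>pscore\<close> and depends on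
    the last covariate but not on the last residual; hence \<open>p\<^sub>i \<le> p'\<^sub>i\<close>;
  \<^item> for the last index, \<open>p = (n / (n + 1)) (1 / (1 + d\<^sup>X) - 1 / (1 + d))\<close>.

  So in the rank event \<open>p\<close>, which increases with \<open>d\<close>, is at most the \<open>m\<close>-th smallest \<open>p'\<^sub>i\<close>.
  Block inversion (\<open>Schur_quadratic_form\<close>) splits \<open>d\<close> as \<open>d\<^sup>X\<close> plus \<open>1 / (n + 1)\<close> times the
  quadratic form of the Schur complement at \<open>z - Z\<^sub>0\<close>, and solving for the latter yields exactly the
  radius \<open>rho\<close>, or no constraint at all when \<open>t q' \<ge> n\<close>.

  The event in the theorem also has to be measurable, since \<open>measure\<close> is zero on
  non-measurable sets. Every quantity is built from arithmetic, order statistics and inverses of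
  invertible matrices; the last are measurable by Cramer's rule.
\<close>

section \<open>Positive definite matrices and rank-one updates\<close>

definition pos_def :: "real^'p^'p \<Rightarrow> bool" where
  "pos_def A \<longleftrightarrow> transpose A = A \<and> (\<forall>x. x \<noteq> 0 \<longrightarrow> 0 < x \<bullet> (A *v x))"

lemma inner_matrix_vector: "x \<bullet> (A *v y) = (transpose A *v x) \<bullet> (y :: real^'p)"
  for A :: "real^'p^'q"
  by (metis dot_lmul_matrix transpose_matrix_vector)

lemma pos_def_self_adjoint:
  assumes "pos_def A" shows "x \<bullet> (A *v y) = (A *v x) \<bullet> y"
  using assms inner_matrix_vector[of x A y] by (simp add: pos_def_def)

lemma pos_def_invertible:
  assumes "pos_def A" shows "invertible A"
proof -
  have "x = 0" if "A *v x = 0" for x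
    using assms that unfolding pos_def_def by (metis inner_zero_right less_irrefl)
  then show ?thesis
    using invertible_left_inverse matrix_left_invertible_ker by blast
qed

lemma matrix_inv_inverse:
  assumes "invertible A"
  shows "A ** matrix_inv A = mat 1" "matrix_inv A ** A = mat 1"
  using someI_ex[OF assms[unfolded invertible_def]] unfolding matrix_inv_def by auto

lemma invertible_matrix_inv_unique:
  fixes A :: "real^'p^'p"
  assumes "invertible A" and "A *v h = b"
  shows "matrix_inv A *v b = h"
  using assms matrix_inv_inverse(2)[OF assms(1)]
  by (metis matrix_vector_mul_assoc matrix_vector_mul_lid)

lemma pos_def_solve:
  assumes "pos_def A" shows "A *v (matrix_inv A *v b) = b"
  using matrix_inv_inverse(1)[OF pos_def_invertible[OF assms]]
  by (metis matrix_vector_mul_assoc matrix_vector_mul_lid)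

lemma pos_def_inv_self_adjoint:
  assumes "pos_def A" shows "x \<bullet> (matrix_inv A *v y) = (matrix_inv A *v x) \<bullet> y"
  by (metis assms pos_def_self_adjoint pos_def_solve)

lemma pos_def_inv_nonneg:
  assumes "pos_def A" shows "0 \<le> x \<bullet> (matrix_inv A *v x)"
proof (cases "matrix_inv A *v x = 0")
  case False
  with assms have "0 < (matrix_inv A *v x) \<bullet> (A *v (matrix_inv A *v x))"
    unfolding pos_def_def by blast
  then show ?thesis by (simp add: pos_def_solve[OF assms] inner_commute)
qed simp

text \<open>
  Only the action of the updated matrix on vectors is needed, so the update \<open>A + s u u\<^sup>T\<close> is
  described through it. With \<open>g = A\<^sup>-\<^sup>1 u\<close>, the vector \<open>h\<close> of the proof is the solution of
  \<open>A' h = y\<close> obtained from the ansatz \<open>h = A\<^sup>-\<^sup>1 y - \<beta> g\<close>.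
\<close>

lemma Sherman_Morrison_quadratic_form:
  fixes A A' :: "real^'p^'p"
  assumes A: "pos_def A" and A': "pos_def A'" and s: "s \<ge> 0"
    and upd: "\<And>x. A' *v x = A *v x + (s * (u \<bullet> x)) *\<^sub>R u"
  shows "y \<bullet> (matrix_inv A' *v y) =
    y \<bullet> (matrix_inv A *v y)
      - s * (y \<bullet> (matrix_inv A *v u))\<^sup>2 / (1 + s * (u \<bullet> (matrix_inv A *v u)))"
proof -
  define g where "g = matrix_inv A *v u"
  define e where "e = 1 + s * (u \<bullet> g)"
  define h where "h = matrix_inv A *v y - (s * (y \<bullet> g) / e) *\<^sub>R g"
  have e: "e > 0" unfolding e_def g_def using s pos_def_inv_nonneg[OF A, of u]
    by (simp add: add_pos_nonneg)
  have uy: "u \<bullet> (matrix_inv A *v y) = y \<bullet> g"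
    unfolding g_def by (metis A inner_commute pos_def_inv_self_adjoint)
  have Ag: "A *v g = u" unfolding g_def by (rule pos_def_solve[OF A])
  have Ay: "A *v (matrix_inv A *v y) = y" by (rule pos_def_solve[OF A])
  have c: "s * (y \<bullet> g - s * (y \<bullet> g) / e * (u \<bullet> g)) = s * (y \<bullet> g) / e"
    using e unfolding e_def by (simp add: field_simps)
  have "A' *v h = y - (s * (y \<bullet> g) / e) *\<^sub>R u + (s * (y \<bullet> g - s * (y \<bullet> g) / e * (u \<bullet> g))) *\<^sub>R u"
    unfolding upd by (simp add: h_def matrix_vector_mult_diff_distrib matrix_vector_mult_scaleR Ag Ay
        inner_diff_right uy)
  then have "A' *v h = y" unfolding c by simp
  then have "matrix_inv A' *v y = h"
    by (rule invertible_matrix_inv_unique[OF pos_def_invertible[OF A']])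
  then show ?thesis
    unfolding h_def by (simp add: inner_diff_right power2_eq_square e_def g_def)
qed

section \<open>Ridge leverages of a centred sample\<close>

definition ridge :: "real \<Rightarrow> real^'p^'n \<Rightarrow> real^'p^'p" where
  "ridge c B = transpose B ** B + c *\<^sub>R mat 1"

definition centred :: "('n::finite \<Rightarrow> real^'p) \<Rightarrow> real^'p^'n" where
  "centred v = (\<chi> i. v i - avg v)"

definition ridge_form :: "real \<Rightarrow> ('n::finite \<Rightarrow> real^'p) \<Rightarrow> real^'p \<Rightarrow> real^'p \<Rightarrow> real" where
  "ridge_form c v a b = a \<bullet> (matrix_inv (ridge c (centred v)) *v b)"

text \<open>
  The diagonal entry of the ridge hat matrix \<open>B (B\<^sup>T B + c I)\<^sup>-\<^sup>1 B\<^sup>T\<close> for \<open>B = centred v\<close>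
  (see \<open>hat_matrix_diag\<close>).
\<close>

definition leverage :: "real \<Rightarrow> ('n::finite \<Rightarrow> real^'p) \<Rightarrow> 'n \<Rightarrow> real" where
  "leverage c v i = ridge_form c v (centred v $ i) (centred v $ i)"

lemma scaleR_mat_mult_vec: "((c::real) *\<^sub>R mat 1) *v x = c *\<^sub>R (x :: real^'p)"
  by (metis scaleR_matrix_vector_assoc matrix_vector_mul_lid)

lemma gram_mult_vec:
  fixes B :: "real^'p^'n"
  shows "(transpose B ** B) *v x = (\<Sum>i\<in>UNIV. (B $ i \<bullet> x) *\<^sub>R B $ i)"
proof -
  have "(transpose B ** B) *v x = transpose B *v (B *v x)"
    by (simp add: matrix_vector_mul_assoc)
  also have "\<dots> = (\<Sum>i\<in>UNIV. (B $ i \<bullet> x) *\<^sub>R B $ i)"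
    by (simp add: vec_eq_iff matrix_vector_mult_def transpose_def inner_vec_def mult.commute)
  finally show ?thesis .
qed

lemma ridge_mult_vec: "ridge c B *v x = (\<Sum>i\<in>UNIV. (B $ i \<bullet> x) *\<^sub>R B $ i) + c *\<^sub>R x"
  by (simp add: ridge_def matrix_vector_mult_add_rdistrib gram_mult_vec scaleR_mat_mult_vec)

lemma pos_def_ridge:
  assumes "c > 0" shows "pos_def (ridge c (B :: real^'p^'n))"
  unfolding pos_def_def
proof (intro conjI allI impI)
  show "transpose (ridge c B) = ridge c B"
    by (auto simp: ridge_def vec_eq_iff transpose_def matrix_matrix_mult_def mat_def mult.commute)
  fix x :: "real^'p" assume "x \<noteq> 0"
  then have "0 < c * (x \<bullet> x)" using assms by simp
  moreover have "0 \<le> (\<Sum>i\<in>UNIV. (B $ i \<bullet> x) * (x \<bullet> B $ i))"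
    by (intro sum_nonneg) (simp add: inner_commute)
  ultimately show "0 < x \<bullet> (ridge c B *v x)"
    by (simp add: ridge_mult_vec inner_add_right inner_sum_right)
qed

lemma sum_UNIV_option:
  fixes h :: "'n::finite option \<Rightarrow> 'a::comm_monoid_add"
  shows "(\<Sum>j\<in>UNIV. h j) = h None + (\<Sum>i\<in>UNIV. h (Some i))"
  by (simp add: UNIV_option_conv sum.reindex)

lemma sum_centred: "(\<Sum>i\<in>UNIV. centred v $ i) = 0"
  by (simp add: centred_def avg_def sum_subtractf sum_constant_scaleR del: sum_constant)

section \<open>Adding one observation to the sample\<close>

text \<open>
  The mean of all \<open>n + 1\<close> observations is the mean of the first \<open>n\<close> moved by \<open>u / (n + 1)\<close>.
\<close>

lemma centred_option:
  fixes v :: "'n::finite option \<Rightarrow> real^'p"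
  defines "u \<equiv> v None - avg (\<lambda>i. v (Some i))"
  shows "centred v $ Some i = centred (\<lambda>i. v (Some i)) $ i - (1 / (real CARD('n) + 1)) *\<^sub>R u"
    and "centred v $ None = (real CARD('n) / (real CARD('n) + 1)) *\<^sub>R u"
proof -
  let ?n = "real CARD('n)" and ?a = "avg (\<lambda>i. v (Some i))"
  have n: "?n > 0" by simp
  have sm: "(\<Sum>i\<in>UNIV. v (Some i)) = ?n *\<^sub>R ?a" by (simp add: avg_def)
  have "avg v = (1 / (?n + 1)) *\<^sub>R (v None + ?n *\<^sub>R ?a)"
    by (simp add: avg_def[of v] sum_UNIV_option sm add.commute)
  also have "v None = u + ?a" by (simp add: u_def)
  also have "(1 / (?n + 1)) *\<^sub>R (u + ?a + ?n *\<^sub>R ?a) = (1 / (?n + 1)) *\<^sub>R (u + (?n + 1) *\<^sub>R ?a)"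
    by (simp add: algebra_simps)
  also have "\<dots> = (1 / (?n + 1)) *\<^sub>R u + ?a"
    using n by (simp add: scaleR_add_right del: scaleR_left.add)
  finally have av: "avg v = ?a + (1 / (?n + 1)) *\<^sub>R u" by (simp add: add.commute)
  show "centred v $ Some i = centred (\<lambda>i. v (Some i)) $ i - (1 / (?n + 1)) *\<^sub>R u"
    by (simp add: centred_def av)
  have "centred v $ None = u - (1 / (?n + 1)) *\<^sub>R u"
    by (simp add: centred_def av) (simp add: u_def)
  also have "\<dots> = (1 - 1 / (?n + 1)) *\<^sub>R u" by (simp add: scaleR_diff_left)
  also have "1 - 1 / (?n + 1) = ?n / (?n + 1)" using n by (simp add: field_simps)
  finally show "centred v $ None = (?n / (?n + 1)) *\<^sub>R u" .
qed

text \<open>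
  By \<open>centred_option\<close> the new centred matrix is the old one, padded with a zero row, plus
  \<open>v u\<^sup>T\<close> with \<open>v = (-1, \<dots>, -1, n) / (n + 1)\<close>. The cross terms in its Gram matrix vanish because the
  old rows sum to zero, and \<open>\<parallel>v\<parallel>\<^sup>2 = n / (n + 1)\<close>.
\<close>

lemma ridge_centred_option:
  fixes v :: "'n::finite option \<Rightarrow> real^'p"
  defines "u \<equiv> v None - avg (\<lambda>i. v (Some i))"
  shows "ridge c (centred v) *v x = ridge c (centred (\<lambda>i. v (Some i))) *v x
    + (real CARD('n) / (real CARD('n) + 1) * (u \<bullet> x)) *\<^sub>R u"
proof -
  let ?n = "real CARD('n)"
  define b where "b = (\<lambda>i. centred (\<lambda>i. v (Some i)) $ i)"
  define t where "t = 1 / (?n + 1)"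
  have n: "?n > 0" by simp
  have b0: "(\<Sum>i\<in>UNIV. b i) = 0" unfolding b_def by (rule sum_centred)
  have b1: "(\<Sum>i\<in>UNIV. b i \<bullet> x) = 0" by (simp add: b0 flip: inner_sum_left)
  have S: "((b i - t *\<^sub>R u) \<bullet> x) *\<^sub>R (b i - t *\<^sub>R u)
      = (b i \<bullet> x) *\<^sub>R b i - (t * (u \<bullet> x)) *\<^sub>R b i - (b i \<bullet> x) *\<^sub>R (t *\<^sub>R u) + (t^2 * (u \<bullet> x)) *\<^sub>R u" for i
    by (simp add: inner_diff_left algebra_simps power2_eq_square)
  have "(\<Sum>i\<in>UNIV. ((b i - t *\<^sub>R u) \<bullet> x) *\<^sub>R (b i - t *\<^sub>R u))
      = (\<Sum>i\<in>UNIV. (b i \<bullet> x) *\<^sub>R b i) - (t * (u \<bullet> x)) *\<^sub>R (\<Sum>i\<in>UNIV. b i)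
        - (\<Sum>i\<in>UNIV. b i \<bullet> x) *\<^sub>R (t *\<^sub>R u) + (?n * (t^2 * (u \<bullet> x))) *\<^sub>R u"
    unfolding S by (simp only: sum.distrib sum_subtractf scaleR_sum_right scaleR_sum_left)
      (simp add: sum_constant_scaleR del: sum_constant)
  also have "\<dots> = (\<Sum>i\<in>UNIV. (b i \<bullet> x) *\<^sub>R b i) + (?n * t^2 * (u \<bullet> x)) *\<^sub>R u"
    by (simp only: b0 b1) (simp add: mult.assoc)
  finally have E: "(\<Sum>i\<in>UNIV. ((b i - t *\<^sub>R u) \<bullet> x) *\<^sub>R (b i - t *\<^sub>R u)) = \<dots>" .
  \<comment> \<open>The squared norm of \<open>v\<close>: \<open>n\<close> entries \<open>-t\<close> and one entry \<open>n t\<close>.\<close>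
  have k: "?n / (?n+1) = ?n * t^2 + (?n * t)^2"
  proof -
    have t: "t * (1 + ?n) = 1" using n unfolding t_def by simp
    have "?n / (?n+1) = ?n * t * (t * (1 + ?n))" unfolding t by (simp add: t_def)
    then show ?thesis by (simp add: power2_eq_square algebra_simps)
  qed
  have "ridge c (centred v) *v x = (?n * t * (u \<bullet> x)) *\<^sub>R ((?n * t) *\<^sub>R u)
     + (\<Sum>i\<in>UNIV. ((b i - t *\<^sub>R u) \<bullet> x) *\<^sub>R (b i - t *\<^sub>R u)) + c *\<^sub>R x"
    by (simp add: ridge_mult_vec sum_UNIV_option centred_option u_def[symmetric] b_def t_def)
  also have "\<dots> = (\<Sum>i\<in>UNIV. (b i \<bullet> x) *\<^sub>R b i) + c *\<^sub>R x + (?n / (?n+1) * (u \<bullet> x)) *\<^sub>R u"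
    unfolding E k by (simp add: algebra_simps power2_eq_square)
  finally show ?thesis by (simp add: ridge_mult_vec b_def)
qed

lemma ridge_form_option:
  fixes v :: "'n::finite option \<Rightarrow> real^'p"
  assumes "c > 0"
  defines "u \<equiv> v None - avg (\<lambda>i. v (Some i))" and "F \<equiv> ridge_form c (\<lambda>i. v (Some i))"
    and "s \<equiv> real CARD('n) / (real CARD('n) + 1)"
  shows "ridge_form c v y y = F y y - s * (F y u)\<^sup>2 / (1 + s * F u u)"
  unfolding F_def ridge_form_def s_def u_def
  by (rule Sherman_Morrison_quadratic_form)
     (auto simp: pos_def_ridge assms ridge_centred_option)

lemma ridge_form_commute: "c > 0 \<Longrightarrow> ridge_form c v a b = ridge_form c v b a"
  unfolding ridge_form_def by (metis pos_def_ridge inner_commute pos_def_inv_self_adjoint)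

lemma ridge_form_nonneg: "c > 0 \<Longrightarrow> 0 \<le> ridge_form c v a a"
  unfolding ridge_form_def by (intro pos_def_inv_nonneg pos_def_ridge)

lemma one_plus_ridge_form_pos: "c > 0 \<Longrightarrow> 0 \<le> s \<Longrightarrow> 0 < 1 + s * ridge_form c v a a"
  by (simp add: add_pos_nonneg ridge_form_nonneg)

lemma ridge_form_linear:
  "ridge_form c v (a - a') b = ridge_form c v a b - ridge_form c v a' b"
  "ridge_form c v a (b - b') = ridge_form c v a b - ridge_form c v a b'"
  "ridge_form c v (k *\<^sub>R a) b = k * ridge_form c v a b"
  "ridge_form c v a (k *\<^sub>R b) = k * ridge_form c v a b"
  by (simp_all add: ridge_form_def inner_diff_left inner_diff_right matrix_vector_mult_diff_distrib
      matrix_vector_mult_scaleR)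

text \<open>
  The last centred row is \<open>s u\<close>, so its leverage is a function of the Mahalanobis norm of \<open>u\<close> alone.
  Subtracting two such leverages (stacked vectors and covariates) cancels the constant \<open>s\<close>.
\<close>

lemma leverage_None:
  fixes v :: "'n::finite option \<Rightarrow> real^'p"
  assumes "c > 0"
  defines "u \<equiv> v None - avg (\<lambda>i. v (Some i))" and "F \<equiv> ridge_form c (\<lambda>i. v (Some i))"
    and "s \<equiv> real CARD('n) / (real CARD('n) + 1)"
  shows "leverage c v None = s * (1 - 1 / (1 + s * F u u))"
proof -
  note upd = ridge_form_option[OF assms(1), of v, folded u_def F_def s_def]
  have s: "s > 0" unfolding s_def by simp
  have e: "1 + s * F u u > 0" unfolding F_def using assms(1) s by (simp add: one_plus_ridge_form_pos)
  have "leverage c v None = s^2 * F u u - s * (s * F u u)^2 / (1 + s * F u u)"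
    unfolding leverage_def centred_option(2)[of v, folded u_def s_def] upd
    by (simp add: F_def ridge_form_linear power2_eq_square)
  also have "\<dots> = s * (1 - 1 / (1 + s * F u u))"
    using e by (simp add: divide_simps) (simp add: power2_eq_square algebra_simps)
  finally show ?thesis .
qed

text \<open>
  Completing the square isolates the dependence on \<open>u\<close> in a single non-positive term: the full hat
  matrix is \<open>P + w w\<^sup>T - b b\<^sup>T / (1 + d)\<close> with \<open>b = \<surd>s B g - w\<close>, and \<open>w\<^sub>i = -1 / ((n + 1) \<surd>s)\<close>. The constant
  \<open>w\<^sub>i\<^sup>2 = 1 / (n (n + 1))\<close> does not depend on the data and cancels in differences of leverages.
\<close>

lemma leverage_Some:
  fixes v :: "'n::finite option \<Rightarrow> real^'p"
  assumes "c > 0"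
  defines "u \<equiv> v None - avg (\<lambda>i. v (Some i))" and "F \<equiv> ridge_form c (\<lambda>i. v (Some i))"
    and "n \<equiv> real CARD('n)"
  defines "s \<equiv> n / (n + 1)"
  shows "leverage c v (Some i) = leverage c (\<lambda>i. v (Some i)) i + 1 / (n * (n + 1))
    - (sqrt s * F (centred (\<lambda>i. v (Some i)) $ i) u + 1 / ((n + 1) * sqrt s))\<^sup>2 / (1 + s * F u u)"
proof -
  note upd = ridge_form_option[OF assms(1), of v, folded u_def F_def n_def, folded s_def]
  define b where "b = centred (\<lambda>i. v (Some i)) $ i"
  define t where "t = 1 / (n + 1)"
  note cen = centred_option(1)[of v i, folded u_def n_def, folded t_def b_def]
  define q where "q = sqrt s"
  have n: "n > 0" unfolding n_def by simp
  have s: "s > 0" unfolding s_def using n by simp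
  have q: "q > 0" "s = q^2" unfolding q_def using s by auto
  have e: "1 + s * F u u > 0" unfolding F_def using assms(1) s by (simp add: one_plus_ridge_form_pos)
  have com: "F u b = F b u" unfolding F_def by (rule ridge_form_commute[OF assms(1)])
  have lin: "F (b - t *\<^sub>R u) x = F b x - t * F u x"
    "F x (b - t *\<^sub>R u) = F x b - t * F x u" for x
    unfolding F_def by (simp_all add: ridge_form_linear)
  have "leverage c v (Some i) = F b b - 2 * t * F b u + t^2 * F u u
      - s * (F b u - t * F u u)^2 / (1 + s * F u u)"
    unfolding leverage_def cen upd lin com by (simp add: power2_eq_square algebra_simps)
  also have "\<dots> = F b b + (t/q)^2 - (q * F b u + t/q)^2 / (1 + s * F u u)"
  proof -
    \<comment> \<open>The polynomial identity behind completing the square, before division by \<open>1 + s B\<close>.\<close>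
    have id: "(2 * t * A - t^2 * B) * (1 + q^2 * B) + q^2 * (A - t * B)^2 + (t/q)^2 * (1 + q^2 * B)
        = (q * A + t/q)^2" for A B
      using q(1) by (simp add: power2_eq_square field_simps)
    have "(q * F b u + t/q)^2 / (1 + s * F u u)
        = 2 * t * F b u - t^2 * F u u + s * (F b u - t * F u u)^2 / (1 + s * F u u) + (t/q)^2"
      unfolding id[of "F b u" "F u u", symmetric] q(2)[symmetric] add_divide_distrib
      using e by simp
    then show ?thesis by simp
  qed
  also have "(t/q)^2 = 1 / (n * (n+1))"
    using n unfolding power_divide q(2)[symmetric] t_def s_def by (simp add: divide_simps power2_eq_square)
  finally show ?thesis
    unfolding leverage_def b_def[symmetric] t_def q_def F_def[symmetric] by (simp add: ac_simps)
qed

section \<open>Order statistics and ranks\<close>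

lemma order_stat_le_iff:
  fixes s :: "'n::finite \<Rightarrow> real"
  assumes m: "1 \<le> m" "m \<le> CARD('n)"
  shows "order_stat s m \<le> a \<longleftrightarrow> m \<le> card {i. s i \<le> a}"
proof -
  define xs where "xs = sorted_list_of_multiset (image_mset s (mset_set UNIV))"
  have mset: "mset xs = image_mset s (mset_set UNIV)" and sorted: "sorted xs"
    unfolding xs_def by simp_all
  have len: "length xs = CARD('n)"
    using arg_cong[OF mset, of size] by simp
  have "card {i. s i \<le> a} = size (filter_mset (\<lambda>y. y \<le> a) (mset xs))"
    unfolding mset by (simp add: filter_mset_image_mset)
  also have "\<dots> = length (filter (\<lambda>y. y \<le> a) xs)"
    by (metis mset_filter size_mset)
  also have "\<dots> = card {i. i < length xs \<and> xs ! i \<le> a}"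
    by (rule length_filter_conv_card)
  finally have card: "card {i. s i \<le> a} = card {i. i < length xs \<and> xs ! i \<le> a}" .
  show ?thesis
  proof
    assume "order_stat s m \<le> a"
    then have "xs ! (m - 1) \<le> a" by (simp add: order_stat_def xs_def)
    moreover have "xs ! i \<le> xs ! (m - 1)" if "i < m" for i
      using sorted_nth_mono[OF sorted, of i "m - 1"] that m len by simp
    ultimately have "{..<m} \<subseteq> {i. i < length xs \<and> xs ! i \<le> a}"
      using m len by fastforce
    from card_mono[OF _ this] show "m \<le> card {i. s i \<le> a}" unfolding card by simp
  next
    assume le: "m \<le> card {i. s i \<le> a}"
    show "order_stat s m \<le> a"
    proof (rule ccontr)
      assume "\<not> order_stat s m \<le> a"
      then have "a < xs ! (m - 1)" by (simp add: order_stat_def xs_def)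
      moreover have "xs ! (m - 1) \<le> xs ! i" if "i < length xs" "m - 1 \<le> i" for i
        using sorted_nth_mono[OF sorted that(2,1)] .
      ultimately have "{i. i < length xs \<and> xs ! i \<le> a} \<subseteq> {..<m - 1}"
        by fastforce
      from card_mono[OF _ this] le show False unfolding card using m by simp
    qed
  qed
qed

text \<open>
  The direction in which order statistics enter the coverage argument: a value of small
  rank, counted with strict inequalities, is bounded by the corresponding order statistic.
\<close>

lemma le_order_stat:
  fixes s :: "'n::finite \<Rightarrow> real"
  assumes m: "1 \<le> m" "m \<le> CARD('n)" and few: "card {i. s i < a} < m"
  shows "a \<le> order_stat s m"
proof (rule ccontr)
  assume "\<not> a \<le> order_stat s m"
  then have "{i. s i \<le> order_stat s m} \<subseteq> {i. s i < a}" by auto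
  from card_mono[OF _ this] few have "card {i. s i \<le> order_stat s m} < m" by simp
  then show False using order_stat_le_iff[OF m, of s "order_stat s m"] by simp
qed

lemma borel_measurable_order_stat:
  fixes s :: "'w \<Rightarrow> 'n::finite \<Rightarrow> real"
  assumes m: "1 \<le> m" "m \<le> CARD('n)" and s: "\<And>i. (\<lambda>\<omega>. s \<omega> i) \<in> borel_measurable M"
  shows "(\<lambda>\<omega>. order_stat (s \<omega>) m) \<in> borel_measurable M"
  unfolding borel_measurable_iff_le
proof
  fix a
  note s[measurable]
  have "card {i. s \<omega> i \<le> a} = (\<Sum>i\<in>UNIV. if s \<omega> i \<le> a then 1 else 0)" for \<omega>
    by (simp add: sum.If_cases)
  then show "{\<omega> \<in> space M. order_stat (s \<omega>) m \<le> a} \<in> sets M"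
    unfolding order_stat_le_iff[OF m] by simp
qed

text \<open>
  Every value up to the \<open>m\<close>-th smallest one has fewer than \<open>m\<close> values strictly below it; with ties
  there may be more than \<open>m\<close> such indices.
\<close>

lemma card_rank_less:
  fixes s :: "'i::finite \<Rightarrow> real"
  assumes m: "m \<le> CARD('i)"
  shows "m \<le> card {j. card {i. s i < s j} < m}"
proof (cases "m = 0")
  case False
  then have m1: "1 \<le> m" by simp
  let ?q = "order_stat s m"
  have "m \<le> card {j. s j \<le> ?q}" using order_stat_le_iff[OF m1 m, of s ?q] by simp
  also have "\<dots> \<le> card {j. card {i. s i < s j} < m}"
  proof (rule card_mono)
    show "{j. s j \<le> ?q} \<subseteq> {j. card {i. s i < s j} < m}"
    proof safe
      fix j assume le: "s j \<le> ?q"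
      show "card {i. s i < s j} < m"
      proof (rule ccontr)
        assume "\<not> card {i. s i < s j} < m"
        then have m': "m \<le> card {i. s i < s j}" by simp
        with m1 have ne: "{i. s i < s j} \<noteq> {}" by (metis card.empty not_one_le_zero order_trans)
        \<comment> \<open>The largest value below \<open>s j\<close> would already have \<open>m\<close> values up to it.\<close>
        define b where "b = Max (s ` {i. s i < s j})"
        have "b < s j" unfolding b_def using ne by (subst Max_less_iff) auto
        moreover have "{i. s i < s j} \<subseteq> {i. s i \<le> b}"
          unfolding b_def by auto
        then have "m \<le> card {i. s i \<le> b}" using m' card_mono[of "{i. s i \<le> b}" "{i. s i < s j}"] by simp
        then have "?q \<le> b" using order_stat_le_iff[OF m1 m, of s b] by simp
        ultimately show False using le by simp
      qed
    qed
  qed simp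
  finally show ?thesis .
qed simp

text \<open>
  The conformal argument. Swapping \<open>j\<close> and \<open>k\<close> preserves the joint law and moves the score of \<open>j\<close>
  to \<open>k\<close>, so the rank events of all indices have the same probability. Their
  indicators add up to at least \<open>m\<close> at every outcome; take expectations.
\<close>

lemma exchangeable_rank_coverage:
  fixes Z :: "'i::finite \<Rightarrow> 'w \<Rightarrow> 'a" and S :: "('i \<Rightarrow> 'a) \<Rightarrow> 'i \<Rightarrow> real"
  assumes "prob_space M" and ex: "exchangeable M N Z"
    and meas: "\<And>i. (\<lambda>z. S z i) \<in> borel_measurable (Pi\<^sub>M UNIV (\<lambda>_. N))"
    and equiv: "\<And>z \<pi> i. \<pi> permutes UNIV \<Longrightarrow> S (\<lambda>j. z (\<pi> j)) i = S z (\<pi> i)"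
    and m: "m \<le> CARD('i)"
  shows "real m / real CARD('i) \<le>
    measure M {\<omega> \<in> space M. card {i. S (\<lambda>j. Z j \<omega>) i < S (\<lambda>j. Z j \<omega>) k} < m}"
proof -
  interpret prob_space M by fact
  define D where "D j = {z \<in> space (Pi\<^sub>M UNIV (\<lambda>_. N)). card {i. S z i < S z j} < m}" for j
  define E where "E j = {\<omega> \<in> space M. card {i. S (\<lambda>j. Z j \<omega>) i < S (\<lambda>j. Z j \<omega>) j} < m}" for j
  have Z: "Z i \<in> measurable M N" for i using ex unfolding exchangeable_def by auto
  have Zp: "(\<lambda>\<omega> i. Z (p i) \<omega>) \<in> measurable M (Pi\<^sub>M UNIV (\<lambda>_. N))" for p
    by (rule measurable_PiM_single') (auto simp: Z measurable_space[OF Z])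
  have D: "D j \<in> sets (Pi\<^sub>M UNIV (\<lambda>_. N))" for j
  proof -
    note meas[measurable]
    have "card {i. S z i < S z j} = (\<Sum>i\<in>UNIV. if S z i < S z j then 1 else 0)" for z
      by (simp add: sum.If_cases)
    then show ?thesis unfolding D_def by simp
  qed
  have EM: "E j \<in> sets M" for j
  proof -
    have "E j = (\<lambda>\<omega> i. Z (id i) \<omega>) -` D j \<inter> space M"
      using measurable_space[OF Zp, of _ id] by (auto simp: E_def D_def)
    then show ?thesis using measurable_sets[OF Zp D] by simp
  qed
  have PE: "prob (E j) = prob (E k)" for j
  proof -
    define \<pi> where "\<pi> = Transposition.transpose j k"
    have \<pi>: "\<pi> permutes UNIV" unfolding \<pi>_def by (rule permutes_swap_id) auto
    have "card {i. S (\<lambda>j. Z (\<pi> j) \<omega>) i < S (\<lambda>j. Z (\<pi> j) \<omega>) k}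
        = card {i. S (\<lambda>j. Z j \<omega>) i < S (\<lambda>j. Z j \<omega>) j}" for \<omega>
    proof -
      have "card {i. S (\<lambda>j. Z j \<omega>) (\<pi> i) < S (\<lambda>j. Z j \<omega>) (\<pi> k)}
        = card (\<pi> -` {i. S (\<lambda>j. Z j \<omega>) i < S (\<lambda>j. Z j \<omega>) (\<pi> k)})" by (simp add: vimage_def)
      also have "\<dots> = card {i. S (\<lambda>j. Z j \<omega>) i < S (\<lambda>j. Z j \<omega>) (\<pi> k)}"
        using \<pi> by (intro card_vimage_inj) (auto simp: permutes_inj permutes_surj)
      finally show ?thesis using equiv[OF \<pi>, of "\<lambda>j. Z j \<omega>"] by (simp add: \<pi>_def)
    qed
    then have "(\<lambda>\<omega> i. Z (\<pi> i) \<omega>) -` D k \<inter> space M = E j"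
      using measurable_space[OF Zp, of _ \<pi>] by (auto simp: E_def D_def)
    moreover have "(\<lambda>\<omega> i. Z i \<omega>) -` D k \<inter> space M = E k"
      using measurable_space[OF Zp, of _ id] by (auto simp: E_def D_def)
    moreover have "measure (distr M (Pi\<^sub>M UNIV (\<lambda>_. N)) (\<lambda>\<omega> i. Z (\<pi> i) \<omega>)) (D k)
      = measure (distr M (Pi\<^sub>M UNIV (\<lambda>_. N)) (\<lambda>\<omega> i. Z i \<omega>)) (D k)"
      using ex \<pi> unfolding exchangeable_def by simp
    ultimately show ?thesis
      using measure_distr[OF Zp[of \<pi>] D[of k]] measure_distr[OF Zp[of id] D[of k]] by simp
  qed
  have "real m = expectation (\<lambda>_. real m)" by (simp add: prob_space)
  also have "\<dots> \<le> expectation (\<lambda>\<omega>. \<Sum>j\<in>UNIV. indicator (E j) \<omega>)"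
  proof (rule integral_mono)
    fix \<omega> assume "\<omega> \<in> space M"
    then have "(\<Sum>j\<in>UNIV. indicator (E j) \<omega>) =
        real (card {j. card {i. S (\<lambda>j. Z j \<omega>) i < S (\<lambda>j. Z j \<omega>) j} < m})"
      by (simp add: indicator_def E_def sum.If_cases)
    then show "real m \<le> (\<Sum>j\<in>UNIV. indicator (E j) \<omega>)"
      using card_rank_less[OF m, of "S (\<lambda>j. Z j \<omega>)"] by simp
  qed (auto intro!: Bochner_Integration.integrable_sum simp: EM emeasure_eq_measure)
  also have "\<dots> = (\<Sum>j\<in>UNIV. prob (E j))"
    by (subst Bochner_Integration.integral_sum) (auto simp: EM emeasure_eq_measure)
  also have "\<dots> = (\<Sum>j\<in>(UNIV :: 'i set). prob (E k))" by (rule sum.cong[OF refl PE])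
  also have "\<dots> = real CARD('i) * prob (E k)" by simp
  finally have "real m \<le> real CARD('i) * prob (E k)" .
  then have "real m / real CARD('i) \<le> prob (E k)" by (simp add: divide_le_eq mult.commute)
  then show ?thesis unfolding E_def .
qed

section \<open>Block matrices and the Schur complement\<close>

lemma pos_def_scaleR:
  assumes "pos_def A" "k > 0" shows "pos_def (k *\<^sub>R A)"
  using assms by (simp add: pos_def_def transpose_scalar flip: scaleR_matrix_vector_assoc)

lemma matrix_inv_scaleR_mult:
  assumes "pos_def A" "k > 0"
  shows "matrix_inv (k *\<^sub>R A) *v b = (1 / k) *\<^sub>R (matrix_inv A *v b)"
  using assms by (intro invertible_matrix_inv_unique pos_def_invertible pos_def_scaleR)
    (simp_all add: matrix_vector_mult_scaleR pos_def_solve flip: scaleR_matrix_vector_assoc)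

lemma sum_UNIV_sum:
  fixes h :: "'k::finite + 'l::finite \<Rightarrow> 'a::comm_monoid_add"
  shows "(\<Sum>s\<in>UNIV. h s) = (\<Sum>a\<in>UNIV. h (Inl a)) + (\<Sum>b\<in>UNIV. h (Inr b))"
  by (simp add: UNIV_Plus_UNIV[symmetric] sum.Plus del: UNIV_Plus_UNIV)

lemma stack_Inl_Inr [simp]: "stack a c $ Inl i = a $ i" "stack a c $ Inr j = c $ j"
  by (simp_all add: stack_def)

lemma vec_eq_sum_iff: "x = y \<longleftrightarrow> (\<forall>i. x $ Inl i = y $ Inl i) \<and> (\<forall>j. x $ Inr j = y $ Inr j)"
  for x y :: "'a^('k::finite + 'l::finite)"
  unfolding vec_eq_iff by (metis sum.exhaust)

lemma inner_stack: "stack a c \<bullet> stack a' c' = a \<bullet> a' + c \<bullet> c'"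
  by (simp add: inner_vec_def sum_UNIV_sum)

lemma stack_eq_0_iff: "stack a c = 0 \<longleftrightarrow> a = 0 \<and> c = 0"
  by (simp add: vec_eq_sum_iff) (simp add: vec_eq_iff)

lemma stack_diff: "stack a c - stack a' c' = stack (a - a') (c - c')"
  by (simp add: vec_eq_sum_iff)

lemma avg_stack: "avg (\<lambda>i. stack (x i) (r i)) = stack (avg x) (avg r)"
  by (simp add: vec_eq_sum_iff avg_def)

lemma matrix_mult_stack:
  fixes S :: "real^('k::finite + 'l::finite)^('k + 'l)"
  shows "S *v stack a c = stack
    ((\<chi> i j. S $ Inl i $ Inl j) *v a + (\<chi> i j. S $ Inl i $ Inr j) *v c)
    ((\<chi> i j. S $ Inr i $ Inl j) *v a + (\<chi> i j. S $ Inr i $ Inr j) *v c)"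
  by (simp add: vec_eq_sum_iff matrix_vector_mult_def sum_UNIV_sum)

lemma matrix_vector_mult_minus: "B *v (- x) = - (B *v x)" for B :: "real^'p^'q"
  using matrix_vector_mult_scaleR[of B "-1" x] by simp

text \<open>
  Block elimination: \<open>S (h\<^sub>1, h\<^sub>2) = (a, c)\<close> is solved by \<open>h\<^sub>2 = A\<^sup>-\<^sup>1 e\<close> and
  \<open>h\<^sub>1 = S\<^sub>1\<^sub>1\<^sup>-\<^sup>1 (a - S\<^sub>1\<^sub>2 h\<^sub>2)\<close>. The Schur complement \<open>A\<close> is invertible because \<open>y\<^sup>T A y\<close> is the quadratic form
  of \<open>S\<close> at \<open>(-S\<^sub>1\<^sub>1\<^sup>-\<^sup>1 S\<^sub>1\<^sub>2 y, y)\<close>.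
\<close>

lemma Schur_quadratic_form:
  fixes S :: "real^('k::finite + 'l::finite)^('k + 'l)" and a :: "real^'k" and c :: "real^'l"
  assumes S: "pos_def S"
  defines "S11 \<equiv> \<chi> i j. S $ Inl i $ Inl j" and "S12 \<equiv> \<chi> i j. S $ Inl i $ Inr j"
    and "S21 \<equiv> \<chi> i j. S $ Inr i $ Inl j" and "S22 \<equiv> \<chi> i j. S $ Inr i $ Inr j"
  defines "A \<equiv> S22 - S21 ** matrix_inv S11 ** S12"
    and "e \<equiv> c - S21 *v (matrix_inv S11 *v a)"
  shows "stack a c \<bullet> (matrix_inv S *v stack a c) = a \<bullet> (matrix_inv S11 *v a) + e \<bullet> (matrix_inv A *v e)"
proof -
  note mult = matrix_mult_stack[of S, folded S11_def S12_def S21_def S22_def]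
  have sym: "S $ i $ j = S $ j $ i" for i j
  proof -
    have "S $ i $ j = transpose S $ j $ i" by (simp add: transpose_def)
    also have "transpose S = S" using S by (simp add: pos_def_def)
    finally show ?thesis .
  qed
  have S11: "pos_def S11"
    unfolding pos_def_def
  proof (intro conjI allI impI)
    show "transpose S11 = S11" by (simp add: vec_eq_iff transpose_def S11_def sym)
    fix y :: "real^'k" assume "y \<noteq> 0"
    then have "0 < stack y 0 \<bullet> (S *v stack y (0::real^'l))"
      using S unfolding pos_def_def by (simp add: stack_eq_0_iff)
    then show "0 < y \<bullet> (S11 *v y)" by (simp add: mult inner_stack)
  qed
  have S12: "transpose S21 = S12" by (simp add: vec_eq_iff transpose_def S12_def S21_def sym)
  have A_mult: "A *v y = S22 *v y - S21 *v (matrix_inv S11 *v (S12 *v y))" for y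
    by (simp add: A_def matrix_vector_mult_diff_rdistrib matrix_vector_mul_assoc matrix_mul_assoc)
  have adj: "x \<bullet> (matrix_inv S11 *v (S12 *v y)) = (S21 *v (matrix_inv S11 *v x)) \<bullet> y" for x y
    using inner_matrix_vector[of "matrix_inv S11 *v x" S12 y]
    by (simp add: pos_def_inv_self_adjoint[OF S11] S12[symmetric])
  have inv: "invertible A"
  proof -
    have "y = 0" if "A *v y = 0" for y
    proof (rule ccontr)
      assume "y \<noteq> 0"
      let ?h = "stack (- (matrix_inv S11 *v (S12 *v y))) y"
      have "S *v ?h = stack 0 (A *v y)"
        unfolding mult by (simp add: A_mult pos_def_solve[OF S11] matrix_vector_mult_minus)
      then have "?h \<bullet> (S *v ?h) = 0" using that by (simp add: inner_stack)
      moreover have "0 < ?h \<bullet> (S *v ?h)"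
        using S \<open>y \<noteq> 0\<close> unfolding pos_def_def by (simp add: stack_eq_0_iff)
      ultimately show False by simp
    qed
    then show ?thesis using invertible_left_inverse matrix_left_invertible_ker by blast
  qed
  define h2 where "h2 = matrix_inv A *v e"
  define h1 where "h1 = matrix_inv S11 *v (a - S12 *v h2)"
  have Ah2: "A *v h2 = e"
    unfolding h2_def using matrix_inv_inverse(1)[OF inv]
    by (metis matrix_vector_mul_assoc matrix_vector_mul_lid)
  have "S *v stack h1 h2 = stack a c"
    unfolding mult using Ah2
    by (simp add: h1_def pos_def_solve[OF S11] A_mult matrix_vector_mult_diff_distrib e_def algebra_simps)
  then have "matrix_inv S *v stack a c = stack h1 h2"
    by (rule invertible_matrix_inv_unique[OF pos_def_invertible[OF S]])
  then have "stack a c \<bullet> (matrix_inv S *v stack a c) = a \<bullet> h1 + c \<bullet> h2"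
    by (simp add: inner_stack)
  also have "a \<bullet> h1 = a \<bullet> (matrix_inv S11 *v a) - (S21 *v (matrix_inv S11 *v a)) \<bullet> h2"
    by (simp add: h1_def matrix_vector_mult_diff_distrib inner_diff_right adj)
  finally show ?thesis by (simp add: e_def h2_def inner_diff_left)
qed

section \<open>The quantities of the prediction set in terms of leverages\<close>

lemma Bmat_eq: "Bmat x r = centred (\<lambda>i. stack (x i) (r i))"
  by (simp add: Bmat_def centred_def)

lemma BXmat_eq: "BXmat x r = centred x"
  by (simp add: BXmat_def Bmat_def centred_def avg_stack vec_eq_iff)

lemma Sig_eq:
  fixes x :: "'n::finite \<Rightarrow> real^'k::finite"
  shows "Sig lam x r = (1 / real CARD('n)) *\<^sub>R
    ridge (real CARD('n) * lam) (centred (\<lambda>i. stack (x i) (r i)))"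
  by (simp add: Sig_def ridge_def Bmat_eq scaleR_add_right)

lemma Sig11_eq:
  fixes x :: "'n::finite \<Rightarrow> real^'k::finite"
  shows "Sig11 lam x r = (1 / real CARD('n)) *\<^sub>R ridge (real CARD('n) * lam) (centred x)"
  by (simp add: Sig11_def Sig_eq ridge_def matrix_matrix_mult_def transpose_def centred_def mat_def
      avg_stack vec_eq_iff)

lemma hat_matrix_diag:
  "(centred v ** matrix_inv (ridge c (centred v)) ** transpose (centred v)) $ i $ i = leverage c v i"
  unfolding leverage_def ridge_form_def
  by (simp add: matrix_matrix_mult_def transpose_def inner_vec_def matrix_vector_mult_def
      sum_distrib_left sum_distrib_right mult.assoc)
    (rule sum.swap)

lemma Pmat_diag:
  fixes x :: "'n::finite \<Rightarrow> real^'k::finite"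
  shows "Pmat lam x r $ i $ i = leverage (real CARD('n) * lam) (\<lambda>i. stack (x i) (r i)) i"
  using hat_matrix_diag unfolding Pmat_def Bmat_eq ridge_def by blast

lemma PXXmat_diag:
  fixes x :: "'n::finite \<Rightarrow> real^'k::finite"
  shows "PXXmat lam x r $ i $ i = leverage (real CARD('n) * lam) x i"
  using hat_matrix_diag unfolding PXXmat_def BXmat_eq ridge_def by blast

lemma Sig11_inv_mult:
  fixes x :: "'n::finite \<Rightarrow> real^'k::finite"
  assumes "lam > 0"
  shows "y \<bullet> (matrix_inv (Sig11 lam x r) *v z) = real CARD('n) * ridge_form (real CARD('n) * lam) x y z"
  unfolding Sig11_eq ridge_form_def
  using assms by (subst matrix_inv_scaleR_mult) (auto intro!: pos_def_ridge)

lemma Sig_inv_mult: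
  fixes x :: "'n::finite \<Rightarrow> real^'k::finite"
  assumes "lam > 0"
  shows "y \<bullet> (matrix_inv (Sig lam x r) *v z) =
    real CARD('n) * ridge_form (real CARD('n) * lam) (\<lambda>i. stack (x i) (r i)) y z"
  unfolding Sig_eq ridge_form_def
  using assms by (subst matrix_inv_scaleR_mult) (auto intro!: pos_def_ridge)

lemma dX_eq:
  fixes x :: "'n::finite \<Rightarrow> real^'k::finite"
  assumes "lam > 0"
  shows "dX lam x r x' = real CARD('n) / (real CARD('n) + 1) *
    ridge_form (real CARD('n) * lam) x (x' - avg x) (x' - avg x)"
  by (simp add: dX_def Sig11_inv_mult[OF assms] xc_def)

lemma norm_vvec: "norm (vvec :: real^('n::finite option)) = sqrt (real CARD('n) / (real CARD('n) + 1))"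
proof -
  let ?n = "real CARD('n)"
  have "(vvec :: real^('n option)) \<bullet> vvec = (1 / (?n + 1))\<^sup>2 * (?n\<^sup>2 + ?n)"
    by (simp add: vvec_def inner_vec_def sum_UNIV_option power2_eq_square)
       (simp add: algebra_simps flip: add_divide_distrib)
  also have "?n\<^sup>2 + ?n = ?n * (?n + 1)" by (simp add: power2_eq_square algebra_simps)
  finally show ?thesis by (simp add: norm_eq_sqrt_inner power2_eq_square)
qed

lemma bX_Some:
  fixes x :: "'n::finite \<Rightarrow> real^'k::finite"
  assumes "lam > 0"
  defines "n \<equiv> real CARD('n)"
  shows "bX lam x r x' $ Some i =
    sqrt (n / (n + 1)) * ridge_form (n * lam) x (centred x $ i) (x' - avg x)
      + 1 / ((n + 1) * sqrt (n / (n + 1)))"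
proof -
  have n: "n > 0" unfolding n_def by simp
  have "(BXmat x r *v (matrix_inv (Sig11 lam x r) *v xc x x')) $ i
      = n * ridge_form (n * lam) x (centred x $ i) (x' - avg x)"
    unfolding n_def by (simp add: matrix_vector_mul_component BXmat_eq Sig11_inv_mult[OF assms(1)] xc_def)
  moreover have "(vvec :: real^('n option)) $ Some i = - (1 / (n + 1))"
    by (simp add: vvec_def n_def)
  ultimately show ?thesis using n
    by (simp add: bX_def wvec_def norm_vvec n_def[symmetric] ac_simps)
qed

lemma pscore_eq:
  fixes x :: "'n::finite \<Rightarrow> real^'k::finite"
  defines "n \<equiv> real CARD('n)"
  shows "pscore lam x r x' i =
    leverage (n * lam) (\<lambda>i. stack (x i) (r i)) i - leverage (n * lam) x i
      + (bX lam x r x' $ Some i)\<^sup>2 / (1 + dX lam x r x')"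
  by (simp add: pscore_def Pmat_diag PXXmat_diag n_def)

text \<open>
  The conformity score of the full sample. In the applications the index type has \<open>n + 1\<close> elements
  while \<open>c = n \<lambda>\<close>: the penalty is that of the calibration sample, which makes the full ridge
  matrix an exact rank-one update of the calibration one.
\<close>

definition score ::
  "real \<Rightarrow> ('i::finite \<Rightarrow> real^'k::finite) \<Rightarrow> ('i \<Rightarrow> real^'l::finite) \<Rightarrow> 'i \<Rightarrow> real" where
  "score c x r j = leverage c (\<lambda>i. stack (x i) (r i)) j - leverage c x j"

text \<open>
  By \<open>leverage_Some\<close> for both leverages the difference is the term \<open>b\<^sub>i\<^sup>2 / (1 + d)\<close> of the stacked sample;
  the corresponding term of the covariates is kept in \<open>pscore\<close>.
\<close>

lemma score_le_pscore:
  fixes x :: "'n::finite option \<Rightarrow> real^'k::finite" and r :: "'n option \<Rightarrow> real^'l::finite"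
  assumes lam: "lam > 0"
  shows "score (real CARD('n) * lam) x r (Some i)
    \<le> pscore lam (\<lambda>i. x (Some i)) (\<lambda>i. r (Some i)) (x None) i"
proof -
  have c: "real CARD('n) * lam > 0" using lam by simp
  show ?thesis
    unfolding score_def pscore_eq leverage_Some[OF c] dX_eq[OF lam] bX_Some[OF lam]
    using one_plus_ridge_form_pos[OF c, of "real CARD('n) / (real CARD('n) + 1)"
      "\<lambda>i. stack (x (Some i)) (r (Some i))"
      "stack (x None) (r None) - avg (\<lambda>i. stack (x (Some i)) (r (Some i)))"]
    by (simp add: less_imp_le)
qed

text \<open>
  The left-hand side is the quantity \<open>d\<close> of the stacked sample. It depends on the candidate
  residual \<open>z\<close> only through the quadratic form that defines the prediction set.
\<close>

lemma Schur_Sig: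
  fixes x :: "'n::finite \<Rightarrow> real^'k::finite" and r :: "'n \<Rightarrow> real^'l::finite"
    and x' :: "real^'k" and z :: "real^'l"
  assumes lam: "lam > 0"
  defines "u \<equiv> stack (x' - avg x) (z - avg r)"
  shows "real CARD('n) / (real CARD('n) + 1) *
      ridge_form (real CARD('n) * lam) (\<lambda>i. stack (x i) (r i)) u u
    = dX lam x r x' + (z - Z0 lam x r x') \<bullet> (matrix_inv (schurA lam x r) *v (z - Z0 lam x r x'))
        / (real CARD('n) + 1)"
proof -
  have pd: "pos_def (Sig lam x r)"
    unfolding Sig_eq using lam by (intro pos_def_scaleR pos_def_ridge) auto
  have e: "z - avg r - Sig21 lam x r *v (matrix_inv (Sig11 lam x r) *v xc x x') = z - Z0 lam x r x'"
    by (simp add: Z0_def matrix_vector_mul_assoc)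
  have "u \<bullet> (matrix_inv (Sig lam x r) *v u) = xc x x' \<bullet> (matrix_inv (Sig11 lam x r) *v xc x x')
    + (z - Z0 lam x r x') \<bullet> (matrix_inv (schurA lam x r) *v (z - Z0 lam x r x'))"
    using Schur_quadratic_form[OF pd, of "xc x x'" "z - avg r"]
    unfolding Sig11_def[symmetric] Sig12_def[symmetric] Sig21_def[symmetric] Sig22_def[symmetric]
      schurA_def[symmetric] e
    by (simp add: u_def xc_def)
  then show ?thesis
    unfolding Sig_inv_mult[OF lam] dX_def by (simp add: add_divide_distrib)
qed

lemma score_None:
  fixes x :: "'n::finite option \<Rightarrow> real^'k::finite" and r :: "'n option \<Rightarrow> real^'l::finite"
  assumes lam: "lam > 0"
  defines "xs \<equiv> \<lambda>i. x (Some i)" and "rs \<equiv> \<lambda>i. r (Some i)" and "n \<equiv> real CARD('n)"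
  defines "d \<equiv> dX lam xs rs (x None)" and "z \<equiv> r None - Z0 lam xs rs (x None)"
  shows "score (n * lam) x r None =
    n / (n + 1) * (1 / (1 + d) - 1 / (1 + d + z \<bullet> (matrix_inv (schurA lam xs rs) *v z) / (n + 1)))"
proof -
  have c: "real CARD('n) * lam > 0" using lam by simp
  show ?thesis
    unfolding score_def n_def leverage_None[OF c] avg_stack stack_diff
    using Schur_Sig[OF lam, where x = xs and r = rs and x' = "x None" and z = "r None"] dX_eq[OF lam, of xs rs "x None"]
    by (simp add: xs_def rs_def d_def z_def add.assoc right_diff_distrib)
qed

text \<open>
  With \<open>D = 1 + d\<^sup>X\<close> and \<open>E = 1 + d\<close>, the hypothesis reads \<open>(n / (n + 1)) (1 / D - 1 / E) \<le> p\<close>.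
  Multiplication by \<open>t = (n + 1) D / n\<close> turns it into \<open>1 - D / E \<le> t p\<close>, which bounds \<open>E\<close> exactly when
  \<open>t p < 1\<close>, and then \<open>E - D \<le> D t p / (1 - t p)\<close>.
\<close>

lemma residual_mem_Fset:
  fixes x :: "'n::finite option \<Rightarrow> real^'k::finite" and r :: "'n option \<Rightarrow> real^'l::finite"
  assumes lam: "lam > 0"
  defines "xs \<equiv> \<lambda>i. x (Some i)" and "rs \<equiv> \<lambda>i. r (Some i)" and "n \<equiv> real CARD('n)"
  assumes le: "score (n * lam) x r None
    \<le> order_stat (pscore lam xs rs (x None)) (nat \<lceil>(1 - alpha) * (n + 1)\<rceil>)"
  shows "r None \<in> Fset lam alpha xs rs (x None)"
proof (cases "tfac lam xs rs (x None) * qcut lam alpha xs rs (x None) \<ge> n")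
  case False
  define p where "p = order_stat (pscore lam xs rs (x None)) (nat \<lceil>(1 - alpha) * (n + 1)\<rceil>)"
  define z where "z = r None - Z0 lam xs rs (x None)"
  define Q where "Q = z \<bullet> (matrix_inv (schurA lam xs rs) *v z)"
  define D where "D = 1 + dX lam xs rs (x None)"
  define E where "E = D + Q / (n + 1)"
  define t where "t = tfac lam xs rs (x None)"
  have n: "n > 0" unfolding n_def by simp
  have c: "n * lam > 0" using lam n by simp
  have D: "D > 0" unfolding D_def dX_eq[OF lam] n_def[symmetric]
    using n by (intro one_plus_ridge_form_pos c) simp
  have E: "E > 0"
    unfolding E_def D_def Q_def z_def n_def add.assoc Schur_Sig[OF lam, symmetric]
    using one_plus_ridge_form_pos[OF c, of "n / (n + 1)"] n unfolding n_def by simp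
  have t: "t = (n + 1) / n * D" by (simp add: t_def tfac_def n_def D_def)
  have q: "qcut lam alpha xs rs (x None) = n * p" by (simp add: qcut_def p_def n_def)
  have tp: "t * p < 1" using False n unfolding q t_def[symmetric] by simp
  have "n / (n + 1) * (1 / D - 1 / E) \<le> p"
    using le score_None[OF lam, of x r]
    by (simp add: p_def D_def E_def Q_def z_def n_def xs_def rs_def)
  then have "t * (n / (n + 1) * (1 / D - 1 / E)) \<le> t * p"
    using D n by (intro mult_left_mono) (simp_all add: t)
  also have "t * (n / (n + 1) * (1 / D - 1 / E)) = 1 - D / E"
    using D E n by (simp add: t right_diff_distrib)
  finally have "E * (1 - t * p) \<le> D" using E by (simp add: field_simps)
  then have "(E - D) * (1 - t * p) \<le> D * (t * p)" by (simp add: algebra_simps)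
  then have "E - D \<le> D * (t * p) / (1 - t * p)" using tp by (simp add: pos_le_divide_eq)
  then have "Q \<le> (n + 1) * (D * (t * p) / (1 - t * p))"
    using n by (simp add: E_def pos_divide_le_eq mult.commute)
  also have "\<dots> = t\<^sup>2 * (n * p / (1 - t * p))"
    using n by (simp add: t power2_eq_square)
  also have "\<dots> = rho lam alpha xs rs (x None)"
    using n by (simp add: rho_def q t_def n_def)
  finally show ?thesis
    using False by (simp add: Fset_def Q_def z_def n_def)
qed (simp add: Fset_def n_def)

section \<open>Symmetry of the scores\<close>

lemma sum_permutes_UNIV: "\<pi> permutes UNIV \<Longrightarrow> (\<Sum>j\<in>UNIV. h (\<pi> j)) = (\<Sum>j\<in>UNIV. h j)"
  using sum.permute[of \<pi> UNIV h] by (simp add: comp_def)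

lemma leverage_permute:
  assumes \<pi>: "\<pi> permutes UNIV"
  shows "leverage c (\<lambda>j. v (\<pi> j)) i = leverage c v (\<pi> i)"
proof -
  note perm = sum_permutes_UNIV[OF \<pi>]
  have avg: "avg (\<lambda>j. v (\<pi> j)) = avg v" by (simp add: avg_def perm)
  have cen: "centred (\<lambda>j. v (\<pi> j)) $ j = centred v $ \<pi> j" for j
    by (simp add: centred_def avg)
  have "ridge c (centred (\<lambda>j. v (\<pi> j))) = ridge c (centred v)"
    unfolding ridge_def
    by (simp add: vec_eq_iff matrix_matrix_mult_def transpose_def cen)
      (simp add: perm[of "\<lambda>j. centred v $ j $ _ * centred v $ j $ _"])
  then show ?thesis by (simp add: leverage_def ridge_form_def cen)
qed

section \<open>Measurability\<close>

lemma borel_measurable_vec_nth: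
  fixes f :: "'w \<Rightarrow> real^'p::finite"
  assumes "f \<in> borel_measurable M" shows "(\<lambda>\<omega>. f \<omega> $ i) \<in> borel_measurable M"
  using borel_measurable_inner[OF assms borel_measurable_const[of "axis i 1"]]
  by (simp add: inner_axis)

lemma borel_measurable_vecI:
  fixes f :: "'w \<Rightarrow> real^'p::finite"
  assumes "\<And>i. (\<lambda>\<omega>. f \<omega> $ i) \<in> borel_measurable M" shows "f \<in> borel_measurable M"
  using assms by (subst borel_measurable_euclidean_space) (auto simp: Basis_vec_def inner_axis)

lemma borel_measurable_stack:
  assumes "x \<in> borel_measurable M" "r \<in> borel_measurable M"
  shows "(\<lambda>\<omega>. stack (x \<omega>) (r \<omega>)) \<in> borel_measurable M"
proof (rule borel_measurable_vecI)
  fix s show "(\<lambda>\<omega>. stack (x \<omega>) (r \<omega>) $ s) \<in> borel_measurable M"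
    by (cases s) (simp_all add: borel_measurable_vec_nth assms)
qed

lemma borel_measurable_avg:
  fixes v :: "'w \<Rightarrow> 'n::finite \<Rightarrow> real^'p::finite"
  assumes "\<And>i. (\<lambda>\<omega>. v \<omega> i) \<in> borel_measurable M"
  shows "(\<lambda>\<omega>. avg (v \<omega>)) \<in> borel_measurable M"
  unfolding avg_def using assms by measurable

lemma borel_measurable_det:
  fixes A :: "'w \<Rightarrow> real^'p::finite^'p"
  assumes "\<And>i j. (\<lambda>\<omega>. A \<omega> $ i $ j) \<in> borel_measurable M"
  shows "(\<lambda>\<omega>. det (A \<omega>)) \<in> borel_measurable M"
  unfolding det_def using assms
  by (intro borel_measurable_sum borel_measurable_times borel_measurable_prod) auto

lemma borel_measurable_matrix_inv_mult:
  fixes A :: "'w \<Rightarrow> real^'p::finite^'p"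
  assumes A: "\<And>i j. (\<lambda>\<omega>. A \<omega> $ i $ j) \<in> borel_measurable M" and inv: "\<And>\<omega>. invertible (A \<omega>)"
    and b: "b \<in> borel_measurable M"
  shows "(\<lambda>\<omega>. matrix_inv (A \<omega>) *v b \<omega>) \<in> borel_measurable M"
proof (rule borel_measurable_vecI)
  fix k
  have "A \<omega> *v (matrix_inv (A \<omega>) *v b \<omega>) = b \<omega>" for \<omega>
    using matrix_inv_inverse(1)[OF inv] by (metis matrix_vector_mul_assoc matrix_vector_mul_lid)
  then have "matrix_inv (A \<omega>) *v b \<omega> =
      (\<chi> k. det (\<chi> i j. if j = k then b \<omega> $ i else A \<omega> $ i $ j) / det (A \<omega>))" for \<omega>
    using cramer[of "A \<omega>"] inv invertible_det_nz by blast
  moreover have "(\<lambda>\<omega>. det (\<chi> i j. if j = k then b \<omega> $ i else A \<omega> $ i $ j) / det (A \<omega>))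
      \<in> borel_measurable M"
    using A borel_measurable_vec_nth[OF b]
    by (intro borel_measurable_divide borel_measurable_det) (simp_all add: if_distrib)
  ultimately show "(\<lambda>\<omega>. (matrix_inv (A \<omega>) *v b \<omega>) $ k) \<in> borel_measurable M" by simp
qed

lemma borel_measurable_centred:
  fixes v :: "'w \<Rightarrow> 'n::finite \<Rightarrow> real^'p::finite"
  assumes "\<And>i. (\<lambda>\<omega>. v \<omega> i) \<in> borel_measurable M"
  shows "(\<lambda>\<omega>. centred (v \<omega>) $ i) \<in> borel_measurable M"
  unfolding centred_def using borel_measurable_avg[of v, OF assms] assms by simp

lemma borel_measurable_ridge_form:
  fixes v :: "'w \<Rightarrow> 'n::finite \<Rightarrow> real^'p::finite"
  assumes c: "c > 0" and v: "\<And>i. (\<lambda>\<omega>. v \<omega> i) \<in> borel_measurable M"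
    and a: "a \<in> borel_measurable M" and b: "b \<in> borel_measurable M"
  shows "(\<lambda>\<omega>. ridge_form c (v \<omega>) (a \<omega>) (b \<omega>)) \<in> borel_measurable M"
  unfolding ridge_form_def
proof (intro borel_measurable_inner a borel_measurable_matrix_inv_mult b)
  show "invertible (ridge c (centred (v \<omega>)))" for \<omega> by (intro pos_def_invertible pos_def_ridge c)
  fix i j
  have [measurable]: "(\<lambda>\<omega>. centred (v \<omega>) $ k $ i) \<in> borel_measurable M" for k i
    by (intro borel_measurable_vec_nth borel_measurable_centred v)
  show "(\<lambda>\<omega>. ridge c (centred (v \<omega>)) $ i $ j) \<in> borel_measurable M"
    by (simp add: ridge_def matrix_matrix_mult_def transpose_def)
qed

lemma borel_measurable_leverage:
  fixes v :: "'w \<Rightarrow> 'n::finite \<Rightarrow> real^'p::finite"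
  assumes "c > 0" and "\<And>i. (\<lambda>\<omega>. v \<omega> i) \<in> borel_measurable M"
  shows "(\<lambda>\<omega>. leverage c (v \<omega>) i) \<in> borel_measurable M"
  unfolding leverage_def
  by (intro borel_measurable_ridge_form borel_measurable_centred assms)

text \<open>
  The inverse of the Schur complement is avoided: \<open>Schur_Sig\<close> expresses the quadratic form of the
  prediction set through the ridge forms of the stacked sample and of the covariates.
\<close>

lemma sets_mem_Fset:
  fixes x :: "'w \<Rightarrow> 'n::finite \<Rightarrow> real^'k::finite" and r :: "'w \<Rightarrow> 'n \<Rightarrow> real^'l::finite"
  assumes lam: "lam > 0"
    and m: "1 \<le> nat \<lceil>(1 - alpha) * (real CARD('n) + 1)\<rceil>"
      "nat \<lceil>(1 - alpha) * (real CARD('n) + 1)\<rceil> \<le> CARD('n)"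
    and x: "\<And>i. (\<lambda>\<omega>. x \<omega> i) \<in> borel_measurable M" and r: "\<And>i. (\<lambda>\<omega>. r \<omega> i) \<in> borel_measurable M"
    and x': "x' \<in> borel_measurable M" and z: "z \<in> borel_measurable M"
  shows "{\<omega> \<in> space M. z \<omega> \<in> Fset lam alpha (x \<omega>) (r \<omega>) (x' \<omega>)} \<in> sets M"
proof -
  let ?n = "real CARD('n)"
  have c: "?n * lam > 0" using lam by simp
  note meas = borel_measurable_ridge_form[OF c] borel_measurable_leverage[OF c]
    borel_measurable_centred borel_measurable_avg borel_measurable_stack borel_measurable_diff
    x r x' z
  have d [measurable]: "(\<lambda>\<omega>. dX lam (x \<omega>) (r \<omega>) (x' \<omega>)) \<in> borel_measurable M"
    unfolding dX_eq[OF lam] by (intro borel_measurable_times borel_measurable_const meas)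
  have b [measurable]: "(\<lambda>\<omega>. bX lam (x \<omega>) (r \<omega>) (x' \<omega>) $ Some i) \<in> borel_measurable M" for i
    unfolding bX_Some[OF lam]
    by (intro borel_measurable_add borel_measurable_times borel_measurable_const meas)
  have [measurable]: "(\<lambda>\<omega>. leverage (?n * lam) (\<lambda>i. stack (x \<omega> i) (r \<omega> i)) i) \<in> borel_measurable M"
    "(\<lambda>\<omega>. leverage (?n * lam) (x \<omega>) i) \<in> borel_measurable M" for i
    by (intro meas)+
  have "(\<lambda>\<omega>. pscore lam (x \<omega>) (r \<omega>) (x' \<omega>) i) \<in> borel_measurable M" for i
    unfolding pscore_eq by measurable
  note borel_measurable_order_stat[OF m this, measurable]
  have [measurable]: "(\<lambda>\<omega>. qcut lam alpha (x \<omega>) (r \<omega>) (x' \<omega>)) \<in> borel_measurable M"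
    unfolding qcut_def by measurable
  have [measurable]: "(\<lambda>\<omega>. tfac lam (x \<omega>) (r \<omega>) (x' \<omega>)) \<in> borel_measurable M"
    unfolding tfac_def by measurable
  have [measurable]: "(\<lambda>\<omega>. rho lam alpha (x \<omega>) (r \<omega>) (x' \<omega>)) \<in> borel_measurable M"
    unfolding rho_def by measurable
  define Q where "Q \<omega> = (z \<omega> - Z0 lam (x \<omega>) (r \<omega>) (x' \<omega>)) \<bullet>
    (matrix_inv (schurA lam (x \<omega>) (r \<omega>)) *v (z \<omega> - Z0 lam (x \<omega>) (r \<omega>) (x' \<omega>)))" for \<omega>
  define u where "u \<omega> = stack (x' \<omega> - avg (x \<omega>)) (z \<omega> - avg (r \<omega>))" for \<omega>
  have "Q = (\<lambda>\<omega>. (?n + 1) * (?n / (?n + 1) *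
      ridge_form (?n * lam) (\<lambda>i. stack (x \<omega> i) (r \<omega> i)) (u \<omega>) (u \<omega>)
        - dX lam (x \<omega>) (r \<omega>) (x' \<omega>)))"
    unfolding u_def Schur_Sig[OF lam] by (simp add: fun_eq_iff Q_def)
  moreover have "(\<lambda>\<omega>. ridge_form (?n * lam) (\<lambda>i. stack (x \<omega> i) (r \<omega> i)) (u \<omega>) (u \<omega>))
      \<in> borel_measurable M"
    unfolding u_def by (intro meas)
  ultimately have [measurable]: "Q \<in> borel_measurable M"
    using d by simp
  have "z \<omega> \<in> Fset lam alpha (x \<omega>) (r \<omega>) (x' \<omega>) \<longleftrightarrow>
      ?n \<le> tfac lam (x \<omega>) (r \<omega>) (x' \<omega>) * qcut lam alpha (x \<omega>) (r \<omega>) (x' \<omega>)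
      \<or> Q \<omega> \<le> rho lam alpha (x \<omega>) (r \<omega>) (x' \<omega>)" for \<omega>
    by (simp add: Fset_def Q_def)
  then show ?thesis by simp
qed

section \<open>Coverage\<close>

text \<open>
  Replacing each calibration score by the larger \<open>pscore\<close> can only lower the number of values below
  the last score.
\<close>

lemma score_rank_imp_mem_Fset:
  fixes x :: "'n::finite option \<Rightarrow> real^'k::finite" and r :: "'n option \<Rightarrow> real^'l::finite"
    and alpha :: real
  assumes lam: "lam > 0"
  defines "m \<equiv> nat \<lceil>(1 - alpha) * (real CARD('n) + 1)\<rceil>" and "s \<equiv> score (real CARD('n) * lam) x r"
  assumes m: "1 \<le> m" "m \<le> CARD('n)" and rank: "card {j. s j < s None} < m"
  shows "r None \<in> Fset lam alpha (\<lambda>i. x (Some i)) (\<lambda>i. r (Some i)) (x None)"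
proof (rule residual_mem_Fset[OF lam], fold m_def s_def, rule le_order_stat[OF m])
  let ?p = "pscore lam (\<lambda>i. x (Some i)) (\<lambda>i. r (Some i)) (x None)"
  have "Some ` {i. ?p i < s None} \<subseteq> {j. s j < s None}"
    using score_le_pscore[OF lam, of x r] by (auto simp: s_def intro: le_less_trans)
  then have "card {i. ?p i < s None} \<le> card {j. s j < s None}"
    by (metis card_image card_mono finite_code inj_Some subset_UNIV inj_on_subset)
  with rank show "card {i. ?p i < s None} < m" by simp
qed

theorem theorem3p6:
  fixes M :: "'w measure"
    and X :: "'n::finite option \<Rightarrow> 'w \<Rightarrow> real^'k::finite"
    and Y :: "'n option \<Rightarrow> 'w \<Rightarrow> real^'l::finite"
    and f :: "real^'k \<Rightarrow> real^'l"
    and lam alpha :: real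
  assumes "prob_space M"
    and "lam > 0"
    and "f \<in> borel_measurable borel"
    and "1 / (real CARD('n) + 1) < alpha" and "alpha < 1"
    and "exchangeable M (borel :: ((real^'k) \<times> (real^'l)) measure)
           (\<lambda>i \<omega>. (X i \<omega>, Y i \<omega>))"
  shows "measure M {\<omega> \<in> space M.
           Y None \<omega> - f (X None \<omega>) \<in>
             Fset lam alpha
               (\<lambda>i. X (Some i) \<omega>)
               (\<lambda>i. Y (Some i) \<omega> - f (X (Some i) \<omega>))
               (X None \<omega>)}
         \<ge> 1 - alpha"
proof -
  interpret prob_space M by fact
  let ?n = "real CARD('n)"
  define m where "m = nat \<lceil>(1 - alpha) * (?n + 1)\<rceil>"
  define S :: "('n option \<Rightarrow> (real^'k) \<times> (real^'l)) \<Rightarrow> 'n option \<Rightarrow> real"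
    where "S z = score (?n * lam) (\<lambda>j. fst (z j)) (\<lambda>j. snd (z j) - f (fst (z j)))" for z
  define F where "F = {\<omega> \<in> space M. Y None \<omega> - f (X None \<omega>) \<in> Fset lam alpha (\<lambda>i. X (Some i) \<omega>)
               (\<lambda>i. Y (Some i) \<omega> - f (X (Some i) \<omega>)) (X None \<omega>)}"
  have c: "?n * lam > 0" using assms by simp
  have pos: "(1 - alpha) * (?n + 1) > 0" using assms by simp
  \<comment> \<open>The lower bound on \<open>alpha\<close> makes the \<open>m\<close>-th order statistic of \<open>n\<close> values well defined.\<close>
  have "1 < alpha * (?n + 1)" using assms(4) by (simp add: pos_divide_less_eq)
  then have "(1 - alpha) * (?n + 1) \<le> of_int (int CARD('n))" by (simp add: left_diff_distrib)
  then have m: "1 \<le> m" "m \<le> CARD('n)" unfolding m_def using pos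
    by (simp_all add: ceiling_le_iff nat_le_iff le_nat_iff Suc_le_eq del: of_int_of_nat_eq)
  have mge: "(1 - alpha) * (?n + 1) \<le> real m"
    unfolding m_def by (rule real_nat_ceiling_ge)
  have XY: "(\<lambda>\<omega>. (X i \<omega>, Y i \<omega>)) \<in> borel_measurable M" for i
    using assms(6) unfolding exchangeable_def by auto
  have X [measurable]: "X i \<in> borel_measurable M" for i
    using measurable_compose[OF XY, of fst]
      borel_measurable_continuous_onI[OF continuous_on_fst[OF continuous_on_id]]
    by simp
  have Y [measurable]: "Y i \<in> borel_measurable M" for i
    using measurable_compose[OF XY, of snd]
      borel_measurable_continuous_onI[OF continuous_on_snd[OF continuous_on_id]]
    by simp
  note assms(3)[measurable]
  have F: "F \<in> sets M"
    unfolding F_def using m unfolding m_def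
    by (intro sets_mem_Fset assms(2)) measurable
  have S_meas: "(\<lambda>z. S z i) \<in> borel_measurable (Pi\<^sub>M UNIV (\<lambda>_. borel))" for i
  proof -
    have [measurable]: "(\<lambda>z :: 'n option \<Rightarrow> (real^'k) \<times> (real^'l). fst (z j))
        \<in> borel_measurable (Pi\<^sub>M UNIV (\<lambda>_. borel))"
      "(\<lambda>z :: 'n option \<Rightarrow> (real^'k) \<times> (real^'l). snd (z j))
        \<in> borel_measurable (Pi\<^sub>M UNIV (\<lambda>_. borel))" for j
      by (rule measurable_compose[OF measurable_component_singleton];
          simp add: borel_measurable_continuous_onI continuous_on_fst continuous_on_snd continuous_on_id)+
    show ?thesis unfolding S_def score_def
      by (intro borel_measurable_diff borel_measurable_leverage[OF c] borel_measurable_stack) measurable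
  qed
  have S_perm: "S (\<lambda>j. z (\<pi> j)) i = S z (\<pi> i)" if "\<pi> permutes UNIV" for z \<pi> i
    unfolding S_def score_def
    using leverage_permute[OF that, of _ "\<lambda>j. stack (fst (z j)) (snd (z j) - f (fst (z j)))"]
      leverage_permute[OF that, of _ "\<lambda>j. fst (z j)"] by simp
  have card: "real CARD('n option) = ?n + 1" by simp
  have "1 - alpha \<le> real m / real CARD('n option)"
    using mge unfolding card by (simp add: pos_le_divide_eq)
  also have "\<dots> \<le> prob {\<omega> \<in> space M.
      card {i. S (\<lambda>j. (X j \<omega>, Y j \<omega>)) i < S (\<lambda>j. (X j \<omega>, Y j \<omega>)) None} < m}"
    using m by (intro exchangeable_rank_coverage[OF assms(1,6)] S_meas S_perm) auto
  also have "\<dots> \<le> prob F"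
  proof (rule finite_measure_mono[OF _ F])
    show "{\<omega> \<in> space M.
      card {i. S (\<lambda>j. (X j \<omega>, Y j \<omega>)) i < S (\<lambda>j. (X j \<omega>, Y j \<omega>)) None} < m} \<subseteq> F"
      using score_rank_imp_mem_Fset[OF assms(2), of alpha] m unfolding F_def S_def m_def by auto
  qed
  finally show ?thesis unfolding F_def .
qed

end
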